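(* For every integer $s$, \[ \sum_{n=0}^\infty \frac{C_{2n}F_{2n+s}}{4^{3n}}=(\alpha F_{s+1}-F_{s-2})\sqrt{\frac25}\,\sqrt{-\beta\sqrt5}-L_{s-2}\sqrt{\frac25}, \] \[ \sum_{n=0}^\infty \frac{C_{2n}L_{2n+s}}{4^{3n}}=(\alpha F_{s-2}+F_{s+1})\sqrt{-2\beta\sqrt5}-F_{s-2}\sqrt{10}, \] \[ \sum_{n=1}^\infty \frac{C_{2n-1}F_{2n+s}}{4^{3n-1}}=2F_s-\frac{L_{s-1}}{\sqrt{10}}-(\alpha F_{s+2}-F_{s-1})\sqrt{\frac{-\beta}{2\sqrt5}}, \] \[ \sum_{n=1}^\infty \frac{C_{2n-1}L_{2n+s}}{4^{3n-1}}=2L_s-\frac{1}{\sqrt2}F_{s-1}\sqrt5-(\alpha F_{s-1}+F_{s+2})\sqrt{\frac{-\beta\sqrt5}{2}}. \]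
   Context: $C_n=\frac{1}{n+1}\binom{2n}{n}$ are the Catalan numbers. $\alpha=\frac{1+\sqrt5}{2}$, $\beta=\frac{1-\sqrt5}{2}$. The Fibonacci and Lucas numbers are defined for all integers $n$ by $F_n=\frac{\alpha^n-\beta^n}{\alpha-\beta}$ and $L_n=\alpha^n+\beta^n$. *)

theory Defs
  imports Complex_Main
begin

definition catalan :: "nat \<Rightarrow> real" where
  "catalan n = 1 / (real n + 1) * real ((2 * n) choose n)"

definition \<alpha> :: real where
  "\<alpha> = (1 + sqrt 5) / 2"

definition \<beta> :: real where
  "\<beta> = (1 - sqrt 5) / 2"

(* Indexed by all integers, hence the integer power powi and the
   Binet form instead of a recursion on nat. *)

definition fibonacci :: "int \<Rightarrow> real" where
  "fibonacci n = (\<alpha> powi n - \<beta> powi n) / (\<alpha> - \<beta>)"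

definition lucas :: "int \<Rightarrow> real" where
  "lucas n = \<alpha> powi n + \<beta> powi n"

end

theory Submission
  imports Defs "HOL-Analysis.Generalised_Binomial_Theorem"
begin

text \<open>
  Splitting the generating function $\sum_n C_n x^n = (1 - \sqrt{1 - 4x}) / (2x)$ into its even and
  odd parts and evaluating at $x = \alpha/8$ and $x = \beta/8$ gives all four series by Binet's formula.
  The radicals collapse to the single one $R = \sqrt{-\beta\sqrt 5}$, because
  $1 - \alpha/2 = \beta^2/2$, $1 - \beta/2 = \alpha^2/2$, $1 + \beta/2 = R^2/2$ and
  $1 + \alpha/2 = \alpha^2 R^2/2$.
\<close>

section \<open>Catalan numbers and their generating function\<close>

lemma catalan_0 [simp]: "catalan 0 = 1"
  by (simp add: catalan_def)

text \<open>Two absorptions with a reflection between them lead from the central binomial of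
  \<open>2 * Suc n\<close> to that of \<open>2 * n\<close>. The recurrence is kept free of division
  so that it can be matched with the one for the binomial coefficients of 1/2.\<close>

lemma catalan_Suc: "(real n + 2) * catalan (Suc n) = 2 * (2 * real n + 1) * catalan n"
proof -
  have eq: "Suc n * ((2 * Suc n) choose Suc n) = 2 * (2 * n + 1) * ((2 * n) choose n)"
  proof -
    \<comment> \<open>The extra factor \<open>Suc n\<close> on both sides pays for the second
      absorption; it is cancelled at the end.\<close>
    have "Suc n * (Suc n * (Suc (Suc (2 * n)) choose Suc n))
        = Suc n * (Suc (Suc (2 * n)) * (Suc (2 * n) choose n))"
      by (simp only: Suc_times_binomial)
    also have "Suc (2 * n) choose n = Suc (2 * n) choose Suc n"
      by (subst binomial_symmetric) auto
    also have "Suc n * (Suc (Suc (2 * n)) * (Suc (2 * n) choose Suc n))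
        = Suc (Suc (2 * n)) * (Suc n * (Suc (2 * n) choose Suc n))"
      by (simp only: mult.left_commute)
    also have "Suc n * (Suc (2 * n) choose Suc n) = Suc (2 * n) * ((2 * n) choose n)"
      by (rule Suc_times_binomial)
    also have "Suc (Suc (2 * n)) * (Suc (2 * n) * ((2 * n) choose n))
        = Suc n * (2 * (2 * n + 1) * ((2 * n) choose n))"
      by (simp add: algebra_simps)
    finally show ?thesis
      by (simp only: mult_cancel1 mult_2_right mult_2 add_Suc add_Suc_right) simp
  qed
  have "real (Suc n * ((2 * Suc n) choose Suc n)) = real (2 * (2 * n + 1) * ((2 * n) choose n))"
    by (simp only: eq)
  then show ?thesis
    unfolding catalan_def by (simp add: field_simps del: binomial_Suc_Suc)
qed

text \<open>These are the coefficients of sqrt(1 - 4x) after the constant term. Both sides equal -2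
  at n = 0 and satisfy the first-order recurrence of \<open>catalan_Suc\<close>.\<close>

lemma gbinomial_half_Suc:
  "((1 / 2 :: real) gchoose Suc n) * (- 4) ^ Suc n = - 2 * catalan n"
proof (induction n)
  case 0
  show ?case by simp
next
  case (Suc n)
  \<comment> \<open>Both sides equal 1/2 times (-1/2 gchoose n + 1). After scaling by a power of -4,
    the factor 1/2 - (n + 1) absorbs one -4 and becomes 2 (2n + 1).\<close>
  have "real (Suc (Suc n)) * ((1 / 2 :: real) gchoose Suc (Suc n))
      = (1 / 2 - real (Suc n)) * ((1 / 2) gchoose Suc n)"
    using gbinomial_absorption[of "Suc n" "1 / 2 :: real"]
      gbinomial_absorb_comp[of "1 / 2 :: real" "Suc n"] by simp
  from arg_cong[OF this, of "\<lambda>t. t * (- 4) ^ Suc (Suc n)"]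
  have "(real n + 2) * (((1 / 2 :: real) gchoose Suc (Suc n)) * (- 4) ^ Suc (Suc n))
      = 2 * (2 * real n + 1) * (((1 / 2) gchoose Suc n) * (- 4) ^ Suc n)"
    by (simp add: algebra_simps)
  also have "\<dots> = - 2 * ((real n + 2) * catalan (Suc n))"
    unfolding Suc.IH catalan_Suc by simp
  also have "\<dots> = (real n + 2) * (- 2 * catalan (Suc n))"
    by (rule mult.left_commute)
  finally show ?case
    by (rule iffD1[OF mult_left_cancel, rotated]) auto
qed

text \<open>The binomial series of sqrt(1 - 4x), stripped of its constant term 1, is -2x times the
  Catalan series.\<close>

lemma catalan_sums:
  fixes x :: real
  assumes "x \<noteq> 0" and "\<bar>4 * x\<bar> < 1"
  shows "(\<lambda>n. catalan n * x ^ n) sums ((1 - sqrt (1 - 4 * x)) / (2 * x))"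
proof -
  have "(\<lambda>n. ((1 / 2) gchoose n) * (- 4 * x) ^ n) sums sqrt (1 + - 4 * x)"
    using assms by (intro sqrt_series) simp
  then have "(\<lambda>n. ((1 / 2) gchoose Suc n) * (- 4 * x) ^ Suc n) sums (sqrt (1 - 4 * x) - 1)"
    by (subst sums_Suc_iff) simp
  moreover have "((1 / 2) gchoose Suc n) * (- 4 * x) ^ Suc n = - 2 * x * (catalan n * x ^ n)" for n
    using gbinomial_half_Suc[of n] by (simp only: power_mult_distrib) (simp add: algebra_simps)
  ultimately have "(\<lambda>n. - 2 * x * (catalan n * x ^ n)) sums (sqrt (1 - 4 * x) - 1)"
    by (simp only:)
  from sums_divide[OF this, of "- 2 * x"] assms(1) show ?thesis
    by (simp add: minus_divide_left)
qed

text \<open>Averaging the generating function at x and -x kills the terms of odd index.\<close>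

lemma catalan_even_sums:
  fixes x :: real
  assumes "x \<noteq> 0" and "\<bar>4 * x\<bar> < 1"
  shows "(\<lambda>n. catalan (2 * n) * x ^ (2 * n)) sums
    ((sqrt (1 + 4 * x) - sqrt (1 - 4 * x)) / (4 * x))"
proof -
  let ?f = "\<lambda>n. (catalan n * x ^ n + catalan n * (- x) ^ n) / 2"
  have "?f sums (((1 - sqrt (1 - 4 * x)) / (2 * x) + (1 - sqrt (1 - 4 * (- x))) / (2 * (- x))) / 2)"
    using assms by (intro sums_divide sums_add catalan_sums) auto
  also have "((1 - sqrt (1 - 4 * x)) / (2 * x) + (1 - sqrt (1 - 4 * (- x))) / (2 * (- x))) / 2
      = (sqrt (1 + 4 * x) - sqrt (1 - 4 * x)) / (4 * x)"
    using assms(1) by (simp add: field_simps)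
  finally have "(\<lambda>n. ?f (2 * n)) sums ((sqrt (1 + 4 * x) - sqrt (1 - 4 * x)) / (4 * x))"
  \<comment> \<open>The averaged series still runs over all indices; passing to the even ones keeps
    its sum because every skipped term is 0.\<close>
  proof (subst sums_mono_reindex)
    show "?f n = 0" if "n \<notin> range (\<lambda>n. 2 * n)" for n
      using that by (cases "even n") (auto elim!: evenE)
  qed (simp_all add: strict_mono_def)
  then show ?thesis by simp
qed

text \<open>Here half the difference of the values at x and -x kills the terms of even
  index.\<close>

lemma catalan_odd_sums:
  fixes x :: real
  assumes "x \<noteq> 0" and "\<bar>4 * x\<bar> < 1"
  shows "(\<lambda>n. catalan (2 * n + 1) * x ^ (2 * n + 1)) sums
    ((2 - sqrt (1 + 4 * x) - sqrt (1 - 4 * x)) / (4 * x))"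
proof -
  let ?f = "\<lambda>n. (catalan n * x ^ n - catalan n * (- x) ^ n) / 2"
  have "?f sums (((1 - sqrt (1 - 4 * x)) / (2 * x) - (1 - sqrt (1 - 4 * (- x))) / (2 * (- x))) / 2)"
    using assms by (intro sums_divide sums_diff catalan_sums) auto
  also have "((1 - sqrt (1 - 4 * x)) / (2 * x) - (1 - sqrt (1 - 4 * (- x))) / (2 * (- x))) / 2
      = (2 - sqrt (1 + 4 * x) - sqrt (1 - 4 * x)) / (4 * x)"
    using assms(1) by (simp add: field_simps)
  finally have "(\<lambda>n. ?f (2 * n + 1)) sums ((2 - sqrt (1 + 4 * x) - sqrt (1 - 4 * x)) / (4 * x))"
  proof (subst sums_mono_reindex)
    show "?f n = 0" if "n \<notin> range (\<lambda>n. 2 * n + 1)" for n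
      using that by (cases "even n") (auto elim!: oddE)
  qed (simp_all add: strict_mono_def)
  then show ?thesis by (simp add: mult_ac)
qed

section \<open>The golden ratio and evaluation at \<alpha>/8 and \<beta>/8\<close>

lemma alpha_beta:
  shows "\<alpha> * \<beta> = - 1" "\<alpha> + \<beta> = 1" "\<alpha> - \<beta> = sqrt 5"
  by (simp_all add: \<alpha>_def \<beta>_def field_simps power2_eq_square)

text \<open>The bounds put \<alpha>/8 and \<beta>/8 inside the radius of convergence 1/4, and the
  signs decide which square roots come out below.\<close>

lemma alpha_bounds: "1 < \<alpha>" "\<alpha> < 2"
  and beta_bounds: "- 1 < \<beta>" "\<beta> < 0"
proof -
  have "2 < sqrt 5" "sqrt 5 < 3"
    by (simp_all add: real_less_rsqrt real_less_lsqrt)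
  then show "1 < \<alpha>" "\<alpha> < 2" "- 1 < \<beta>" "\<beta> < 0"
    by (simp_all add: \<alpha>_def \<beta>_def)
qed

lemma sqrt_alpha_beta:
  shows "sqrt (1 + \<alpha> / 2) = \<alpha> * sqrt (- \<beta> * sqrt 5) * sqrt 2 / 2"
    and "sqrt (1 - \<alpha> / 2) = - \<beta> * sqrt 2 / 2"
    and "sqrt (1 + \<beta> / 2) = sqrt (- \<beta> * sqrt 5) * sqrt 2 / 2"
    and "sqrt (1 - \<beta> / 2) = \<alpha> * sqrt 2 / 2"
proof -
  have [simp]: "sqrt (\<alpha> ^ 2) = \<alpha>" "sqrt (\<beta> ^ 2) = - \<beta>"
    using alpha_bounds beta_bounds by simp_all
  \<comment> \<open>Moves sqrt 2 from denominators to numerators, so that all four roots get a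
    common shape.\<close>
  have half: "x / sqrt 2 = x * sqrt 2 / 2" for x
    by (simp add: real_div_sqrt field_simps)
  have "1 + \<alpha> / 2 = \<alpha> ^ 2 * (- \<beta> * sqrt 5) / 2" "1 - \<alpha> / 2 = \<beta> ^ 2 / 2"
    "1 + \<beta> / 2 = - \<beta> * sqrt 5 / 2" "1 - \<beta> / 2 = \<alpha> ^ 2 / 2"
    by (simp_all add: \<alpha>_def \<beta>_def field_simps power2_eq_square)
  then show "sqrt (1 + \<alpha> / 2) = \<alpha> * sqrt (- \<beta> * sqrt 5) * sqrt 2 / 2"
    "sqrt (1 - \<alpha> / 2) = - \<beta> * sqrt 2 / 2"
    "sqrt (1 + \<beta> / 2) = sqrt (- \<beta> * sqrt 5) * sqrt 2 / 2"
    "sqrt (1 - \<beta> / 2) = \<alpha> * sqrt 2 / 2"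
    by (simp_all only: real_sqrt_divide half real_sqrt_mult[of "\<alpha> ^ 2"] \<open>sqrt (\<alpha> ^ 2) = \<alpha>\<close>
        \<open>sqrt (\<beta> ^ 2) = - \<beta>\<close>)
qed

text \<open>The point \<alpha>/8 is chosen since 8^2 = 4^3: its even powers are \<alpha>^(2n) /
  4^(3n). Dividing by \<alpha>/2 or \<beta>/2 leaves no denominator because 1/\<alpha> =
  -\<beta>.\<close>

lemma catalan_even_alpha_beta_sums:
  shows "(\<lambda>n. catalan (2 * n) * (\<alpha> / 8) ^ (2 * n)) sums
      (sqrt 2 * (sqrt (- \<beta> * sqrt 5) - \<beta> ^ 2))"
    and "(\<lambda>n. catalan (2 * n) * (\<beta> / 8) ^ (2 * n)) sums
      (sqrt 2 * (\<alpha> ^ 2 - \<alpha> * sqrt (- \<beta> * sqrt 5)))"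
proof -
  define R where "R = sqrt (- \<beta> * sqrt 5)"
  have [simp]: "4 * (\<alpha> / 8) = \<alpha> / 2" "4 * (\<beta> / 8) = \<beta> / 2"
    by simp_all
  have nz: "\<alpha> \<noteq> 0" "\<beta> \<noteq> 0"
    using alpha_bounds beta_bounds by auto
  have "(sqrt (1 + \<alpha> / 2) - sqrt (1 - \<alpha> / 2)) / (\<alpha> / 2) = sqrt 2 * (R - \<beta> ^ 2)"
  proof -
    \<comment> \<open>With the division cleared, this is a polynomial identity modulo \<alpha>
      \<beta> = -1, in which R and sqrt 2 are mere indeterminates.\<close>
    have *: "\<alpha> * R * sqrt 2 / 2 - - \<beta> * sqrt 2 / 2 = sqrt 2 * (R - \<beta> ^ 2) * (\<alpha> / 2)"
      using alpha_beta(1) by (simp add: field_simps) algebra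
    show ?thesis
      unfolding sqrt_alpha_beta R_def[symmetric] * using nz by simp
  qed
  moreover have "(sqrt (1 + \<beta> / 2) - sqrt (1 - \<beta> / 2)) / (\<beta> / 2) = sqrt 2 * (\<alpha> ^ 2 - \<alpha> * R)"
  proof -
    have *: "R * sqrt 2 / 2 - \<alpha> * sqrt 2 / 2 = sqrt 2 * (\<alpha> ^ 2 - \<alpha> * R) * (\<beta> / 2)"
      using alpha_beta(1) by (simp add: field_simps) algebra
    show ?thesis
      unfolding sqrt_alpha_beta R_def[symmetric] * using nz by simp
  qed
  ultimately show "(\<lambda>n. catalan (2 * n) * (\<alpha> / 8) ^ (2 * n)) sums
      (sqrt 2 * (sqrt (- \<beta> * sqrt 5) - \<beta> ^ 2))"
    "(\<lambda>n. catalan (2 * n) * (\<beta> / 8) ^ (2 * n)) sums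
      (sqrt 2 * (\<alpha> ^ 2 - \<alpha> * sqrt (- \<beta> * sqrt 5)))"
    using catalan_even_sums[of "\<alpha> / 8"] catalan_even_sums[of "\<beta> / 8"]
      alpha_bounds beta_bounds unfolding R_def by simp_all
qed

text \<open>The summands -4\<beta> and -4\<alpha> are 4/\<alpha> and 4/\<beta>; they end up as the
  terms 2 F_s and 2 L_s of the theorem.\<close>

lemma catalan_odd_alpha_beta_sums:
  shows "(\<lambda>n. catalan (2 * n + 1) * (\<alpha> / 8) ^ (2 * n + 1)) sums
      (- 4 * \<beta> - sqrt 2 * (sqrt (- \<beta> * sqrt 5) + \<beta> ^ 2))"
    and "(\<lambda>n. catalan (2 * n + 1) * (\<beta> / 8) ^ (2 * n + 1)) sums
      (- 4 * \<alpha> + sqrt 2 * (\<alpha> ^ 2 + \<alpha> * sqrt (- \<beta> * sqrt 5)))"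
proof -
  define R where "R = sqrt (- \<beta> * sqrt 5)"
  have [simp]: "4 * (\<alpha> / 8) = \<alpha> / 2" "4 * (\<beta> / 8) = \<beta> / 2"
    by simp_all
  have nz: "\<alpha> \<noteq> 0" "\<beta> \<noteq> 0"
    using alpha_bounds beta_bounds by auto
  have "(2 - sqrt (1 + \<alpha> / 2) - sqrt (1 - \<alpha> / 2)) / (\<alpha> / 2) = - 4 * \<beta> - sqrt 2 * (R + \<beta> ^ 2)"
  proof -
    have *: "2 - \<alpha> * R * sqrt 2 / 2 - - \<beta> * sqrt 2 / 2 = (- 4 * \<beta> - sqrt 2 * (R + \<beta> ^ 2)) * (\<alpha> / 2)"
      using alpha_beta(1) by (simp add: field_simps) algebra
    show ?thesis
      unfolding sqrt_alpha_beta R_def[symmetric] * using nz by simp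
  qed
  moreover have "(2 - sqrt (1 + \<beta> / 2) - sqrt (1 - \<beta> / 2)) / (\<beta> / 2)
      = - 4 * \<alpha> + sqrt 2 * (\<alpha> ^ 2 + \<alpha> * R)"
  proof -
    have *: "2 - R * sqrt 2 / 2 - \<alpha> * sqrt 2 / 2 = (- 4 * \<alpha> + sqrt 2 * (\<alpha> ^ 2 + \<alpha> * R)) * (\<beta> / 2)"
      using alpha_beta(1) by (simp add: field_simps) algebra
    show ?thesis
      unfolding sqrt_alpha_beta R_def[symmetric] * using nz by simp
  qed
  ultimately show "(\<lambda>n. catalan (2 * n + 1) * (\<alpha> / 8) ^ (2 * n + 1)) sums
      (- 4 * \<beta> - sqrt 2 * (sqrt (- \<beta> * sqrt 5) + \<beta> ^ 2))"
    "(\<lambda>n. catalan (2 * n + 1) * (\<beta> / 8) ^ (2 * n + 1)) sums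
      (- 4 * \<alpha> + sqrt 2 * (\<alpha> ^ 2 + \<alpha> * sqrt (- \<beta> * sqrt 5)))"
    using catalan_odd_sums[of "\<alpha> / 8"] catalan_odd_sums[of "\<beta> / 8"]
      alpha_bounds beta_bounds unfolding R_def by simp_all
qed

section \<open>The four series by Binet's formula\<close>

theorem theorem2:
  fixes s :: int
  shows
    "((\<lambda>n::nat. catalan (2 * n) * fibonacci (2 * int n + s) / 4 ^ (3 * n)) sums
       ((\<alpha> * fibonacci (s + 1) - fibonacci (s - 2)) * sqrt (2 / 5) * sqrt (- \<beta> * sqrt 5)
        - lucas (s - 2) * sqrt (2 / 5))) \<and>
     ((\<lambda>n::nat. catalan (2 * n) * lucas (2 * int n + s) / 4 ^ (3 * n)) sums
       ((\<alpha> * fibonacci (s - 2) + fibonacci (s + 1)) * sqrt (- 2 * \<beta> * sqrt 5)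
        - fibonacci (s - 2) * sqrt 10)) \<and>
     ((\<lambda>n::nat. catalan (2 * Suc n - 1) * fibonacci (2 * int (Suc n) + s) / 4 ^ (3 * Suc n - 1)) sums
       (2 * fibonacci s - lucas (s - 1) / sqrt 10
        - (\<alpha> * fibonacci (s + 2) - fibonacci (s - 1)) * sqrt (- \<beta> / (2 * sqrt 5)))) \<and>
     ((\<lambda>n::nat. catalan (2 * Suc n - 1) * lucas (2 * int (Suc n) + s) / 4 ^ (3 * Suc n - 1)) sums
       (2 * lucas s - 1 / sqrt 2 * fibonacci (s - 1) * sqrt 5
        - (\<alpha> * fibonacci (s - 1) + fibonacci (s + 2)) * sqrt (- \<beta> * sqrt 5 / 2)))"
proof -
  \<comment> \<open>With these names each side becomes linear in A and B, and s disappears from the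
    identities. The coefficients involve only \<alpha>, \<beta>, R, u and v, tied by the relations
    in \<open>uv\<close> and \<open>ab\<close>.\<close>
  define A where "A = \<alpha> powi s"
  define B where "B = \<beta> powi s"
  define R where "R = sqrt (- \<beta> * sqrt 5)"
  define u where "u = sqrt (2 :: real)"
  define v where "v = sqrt (5 :: real)"
  have nz: "\<alpha> \<noteq> 0" "\<beta> \<noteq> 0" and uv0: "u \<noteq> 0" "v \<noteq> 0"
    using alpha_bounds beta_bounds by (auto simp: u_def v_def)
  have uv: "u * u = 2" "v * v = 5"
    by (simp_all add: u_def v_def)
  have inv: "1 / \<alpha> = - \<beta>" "1 / \<beta> = - \<alpha>"
    using nz alpha_beta(1) by (simp_all add: field_simps)
  have ab: "\<alpha> - \<beta> = v" "\<alpha> + \<beta> = 1" "\<alpha> * \<beta> = - 1"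
    using alpha_beta by (simp_all add: v_def)
  have powi_alpha: "\<alpha> powi (s + 1) = A * \<alpha>" "\<alpha> powi (s + 2) = A * \<alpha> ^ 2"
    "\<alpha> powi (s - 1) = - A * \<beta>" "\<alpha> powi (s - 2) = A * \<beta> ^ 2"
    using nz arg_cong[OF inv(1), of "\<lambda>t. A * t"] arg_cong[OF inv(1), of "\<lambda>t. A * t ^ 2"]
    by (simp_all add: A_def power_int_add power_int_diff power_divide)
  have powi_beta: "\<beta> powi (s + 1) = B * \<beta>" "\<beta> powi (s + 2) = B * \<beta> ^ 2"
    "\<beta> powi (s - 1) = - B * \<alpha>" "\<beta> powi (s - 2) = B * \<alpha> ^ 2"
    using nz arg_cong[OF inv(2), of "\<lambda>t. B * t"] arg_cong[OF inv(2), of "\<lambda>t. B * t ^ 2"]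
    by (simp_all add: B_def power_int_add power_int_diff power_divide)
  have fib: "fibonacci s = (A - B) / v" "fibonacci (s + 1) = (A * \<alpha> - B * \<beta>) / v"
    "fibonacci (s + 2) = (A * \<alpha> ^ 2 - B * \<beta> ^ 2) / v"
    "fibonacci (s - 1) = (B * \<alpha> - A * \<beta>) / v"
    "fibonacci (s - 2) = (A * \<beta> ^ 2 - B * \<alpha> ^ 2) / v"
    by (simp_all add: fibonacci_def ab powi_alpha powi_beta flip: A_def B_def)
  have luc: "lucas s = A + B" "lucas (s - 1) = - (A * \<beta>) - B * \<alpha>"
    "lucas (s - 2) = A * \<beta> ^ 2 + B * \<alpha> ^ 2"
    by (simp_all add: lucas_def powi_alpha powi_beta flip: A_def B_def)
  have rad: "sqrt (2 / 5) = u / v" "sqrt 10 = u * v" "sqrt (- 2 * \<beta> * sqrt 5) = u * R"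
    "sqrt (- \<beta> / (2 * sqrt 5)) = R / (u * v)" "sqrt (- \<beta> * sqrt 5 / 2) = R / u"
  proof -
    show "sqrt (2 / 5) = u / v" "sqrt (- \<beta> * sqrt 5 / 2) = R / u"
      by (simp_all only: u_def v_def R_def real_sqrt_divide)
    show "sqrt 10 = u * v" "sqrt (- 2 * \<beta> * sqrt 5) = u * R"
      by (simp_all add: u_def v_def R_def flip: real_sqrt_mult)
    \<comment> \<open>Rationalising the denominator exposes R^2 = -\<beta> sqrt 5 under the
      root.\<close>
    have "- \<beta> / (2 * sqrt 5) = - \<beta> * sqrt 5 / (2 * 5)"
      by (simp add: field_simps)
    then show "sqrt (- \<beta> / (2 * sqrt 5)) = R / (u * v)"
      by (simp only: u_def v_def R_def real_sqrt_divide real_sqrt_mult)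
  qed
  have powi_n: "\<alpha> powi (2 * int n + s) = A * \<alpha> ^ (2 * n)" "\<beta> powi (2 * int n + s) = B * \<beta> ^ (2 * n)" for n
  proof -
    \<comment> \<open>With \<open>int (2 * n)\<close> as exponent, the integer power turns into an
      ordinary one.\<close>
    have "\<alpha> powi (int (2 * n) + s) = A * \<alpha> ^ (2 * n)" "\<beta> powi (int (2 * n) + s) = B * \<beta> ^ (2 * n)"
      using nz by (simp_all add: power_int_add A_def B_def del: of_nat_mult)
    then show "\<alpha> powi (2 * int n + s) = A * \<alpha> ^ (2 * n)" "\<beta> powi (2 * int n + s) = B * \<beta> ^ (2 * n)"
      by simp_all
  qed
  have pow_even: "(4 :: real) ^ (3 * n) = 8 ^ (2 * n)" for n
    by (simp add: power_mult)
  \<comment> \<open>The exponent is 3n + 2, and 4^(3n + 2) = 16 * 64^n; the leftover 2 is the reason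
    for the halving in \<open>odd_term\<close>.\<close>
  have pow_odd: "(4 :: real) ^ (3 * Suc n - 1) = 2 * 8 ^ (2 * n + 1)" for n
    by (simp add: power_add power_mult)
  have idx: "2 * Suc n - 1 = 2 * n + 1" for n by simp
  note E = catalan_even_alpha_beta_sums[folded R_def u_def]
  note O = catalan_odd_alpha_beta_sums[folded R_def u_def]
  have even_term:
    "catalan (2 * n) * fibonacci (2 * int n + s) / 4 ^ (3 * n)
      = (A * (catalan (2 * n) * (\<alpha> / 8) ^ (2 * n)) - B * (catalan (2 * n) * (\<beta> / 8) ^ (2 * n))) / v"
    "catalan (2 * n) * lucas (2 * int n + s) / 4 ^ (3 * n)
      = A * (catalan (2 * n) * (\<alpha> / 8) ^ (2 * n)) + B * (catalan (2 * n) * (\<beta> / 8) ^ (2 * n))" for n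
    unfolding fibonacci_def lucas_def powi_n ab pow_even power_divide
    using uv0 by (simp_all add: field_simps)
  \<comment> \<open>The power 2 (n + 1) exceeds the Catalan index 2n + 1 by one, hence the extra
    factors \<alpha> and \<beta>.\<close>
  have odd_term:
    "catalan (2 * Suc n - 1) * fibonacci (2 * int (Suc n) + s) / 4 ^ (3 * Suc n - 1)
      = (A * \<alpha> * (catalan (2 * n + 1) * (\<alpha> / 8) ^ (2 * n + 1))
        - B * \<beta> * (catalan (2 * n + 1) * (\<beta> / 8) ^ (2 * n + 1))) / (2 * v)"
    "catalan (2 * Suc n - 1) * lucas (2 * int (Suc n) + s) / 4 ^ (3 * Suc n - 1)
      = (A * \<alpha> * (catalan (2 * n + 1) * (\<alpha> / 8) ^ (2 * n + 1))
        + B * \<beta> * (catalan (2 * n + 1) * (\<beta> / 8) ^ (2 * n + 1))) / 2" for n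
    unfolding fibonacci_def lucas_def powi_n ab pow_odd power_divide idx
    using uv0 by (simp_all add: field_simps)
  have div_u: "x / u = x * u / 2" and div_uv: "x / (u * v) = x * u / (2 * v)" for x
    using uv0 uv by (simp_all add: field_simps)
  \<comment> \<open>Sort by R: its coefficient is u/v times A + \<alpha> B, the bracket of the
    claim, and the rest is -u/v times L_(s-2). The other three values are matched in the same way,
    each with its own bracket.\<close>
  have val1: "(A * (u * (R - \<beta> ^ 2)) - B * (u * (\<alpha> ^ 2 - \<alpha> * R))) / v
    = (\<alpha> * fibonacci (s + 1) - fibonacci (s - 2)) * sqrt (2 / 5) * R - lucas (s - 2) * sqrt (2 / 5)"
  proof -
    have "\<alpha> * (A * \<alpha> - B * \<beta>) - (A * \<beta> ^ 2 - B * \<alpha> ^ 2) = v * (A + \<alpha> * B)"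
      \<comment> \<open>Writing v as \<alpha> - \<beta> leaves a polynomial identity modulo \<alpha>
        + \<beta> = 1 and \<alpha> \<beta> = -1.\<close>
      unfolding ab(1)[symmetric] using ab(2,3) by algebra
    then have "\<alpha> * fibonacci (s + 1) - fibonacci (s - 2) = A + \<alpha> * B"
      unfolding fib times_divide_eq_right diff_divide_distrib[symmetric] add_divide_distrib[symmetric]
      using uv0 by simp
    then show ?thesis
      unfolding rad luc using uv0 by (simp add: field_simps)
  qed
  have val2: "A * (u * (R - \<beta> ^ 2)) + B * (u * (\<alpha> ^ 2 - \<alpha> * R))
    = (\<alpha> * fibonacci (s - 2) + fibonacci (s + 1)) * sqrt (- 2 * \<beta> * sqrt 5) - fibonacci (s - 2) * sqrt 10"
  proof -
    have "\<alpha> * (A * \<beta> ^ 2 - B * \<alpha> ^ 2) + (A * \<alpha> - B * \<beta>) = v * (A - \<alpha> * B)"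
      unfolding ab(1)[symmetric] using ab(2,3) by algebra
    then have *: "\<alpha> * fibonacci (s - 2) + fibonacci (s + 1) = A - \<alpha> * B"
      unfolding fib times_divide_eq_right diff_divide_distrib[symmetric] add_divide_distrib[symmetric]
      using uv0 by simp
    show ?thesis
      \<comment> \<open>The bracket must collapse before \<open>fib\<close> expands the remaining
        F_(s-2), since \<open>fib\<close> would also rewrite the terms inside it.\<close>
      unfolding rad * unfolding fib using uv0 by (simp add: field_simps)
  qed
  have val3: "(A * \<alpha> * (- 4 * \<beta> - u * (R + \<beta> ^ 2)) - B * \<beta> * (- 4 * \<alpha> + u * (\<alpha> ^ 2 + \<alpha> * R))) / (2 * v)
    = 2 * fibonacci s - lucas (s - 1) / sqrt 10
      - (\<alpha> * fibonacci (s + 2) - fibonacci (s - 1)) * sqrt (- \<beta> / (2 * sqrt 5))"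
  proof -
    have "\<alpha> * (A * \<alpha> ^ 2 - B * \<beta> ^ 2) - (B * \<alpha> - A * \<beta>) = v * (A * \<alpha> - B)"
      unfolding ab(1)[symmetric] using ab(2,3) by algebra
    then have *: "\<alpha> * fibonacci (s + 2) - fibonacci (s - 1) = A * \<alpha> - B"
      unfolding fib times_divide_eq_right diff_divide_distrib[symmetric] add_divide_distrib[symmetric]
      using uv0 by simp
    \<comment> \<open>Sorted into a part free of u and R, a u part and a u R part, which give the
      Fibonacci, Lucas and bracket terms in turn.\<close>
    have **: "A * \<alpha> * (- 4 * \<beta> - u * (R + \<beta> ^ 2)) - B * \<beta> * (- 4 * \<alpha> + u * (\<alpha> ^ 2 + \<alpha> * R))
      = 4 * (A - B) + u * (A * \<beta> + B * \<alpha>) - u * R * (A * \<alpha> - B)"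
      unfolding ab(1)[symmetric] using ab(2,3) by algebra
    show ?thesis
      unfolding rad * ** unfolding luc fib div_u div_uv using uv0 by (simp add: field_simps)
  qed
  have val4: "(A * \<alpha> * (- 4 * \<beta> - u * (R + \<beta> ^ 2)) + B * \<beta> * (- 4 * \<alpha> + u * (\<alpha> ^ 2 + \<alpha> * R))) / 2
    = 2 * lucas s - 1 / u * fibonacci (s - 1) * v
      - (\<alpha> * fibonacci (s - 1) + fibonacci (s + 2)) * sqrt (- \<beta> * sqrt 5 / 2)"
  proof -
    have "\<alpha> * (B * \<alpha> - A * \<beta>) + (A * \<alpha> ^ 2 - B * \<beta> ^ 2) = v * (A * \<alpha> + B)"
      unfolding ab(1)[symmetric] using ab(2,3) by algebra
    then have *: "\<alpha> * fibonacci (s - 1) + fibonacci (s + 2) = A * \<alpha> + B"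
      unfolding fib times_divide_eq_right diff_divide_distrib[symmetric] add_divide_distrib[symmetric]
      using uv0 by simp
    have **: "A * \<alpha> * (- 4 * \<beta> - u * (R + \<beta> ^ 2)) + B * \<beta> * (- 4 * \<alpha> + u * (\<alpha> ^ 2 + \<alpha> * R))
      = 4 * (A + B) - u * (B * \<alpha> - A * \<beta>) - u * R * (A * \<alpha> + B)"
      unfolding ab(1)[symmetric] using ab(2,3) by algebra
    show ?thesis
      unfolding rad * ** unfolding luc fib div_u div_uv using uv0 by (simp add: field_simps)
  qed
  have sum1: "(\<lambda>n. (A * (catalan (2 * n) * (\<alpha> / 8) ^ (2 * n)) - B * (catalan (2 * n) * (\<beta> / 8) ^ (2 * n))) / v)
      sums ((A * (u * (R - \<beta> ^ 2)) - B * (u * (\<alpha> ^ 2 - \<alpha> * R))) / v)"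
    by (intro sums_divide sums_diff sums_mult E)
  have sum2: "(\<lambda>n. A * (catalan (2 * n) * (\<alpha> / 8) ^ (2 * n)) + B * (catalan (2 * n) * (\<beta> / 8) ^ (2 * n)))
      sums (A * (u * (R - \<beta> ^ 2)) + B * (u * (\<alpha> ^ 2 - \<alpha> * R)))"
    by (intro sums_add sums_mult E)
  have sum3: "(\<lambda>n. (A * \<alpha> * (catalan (2 * n + 1) * (\<alpha> / 8) ^ (2 * n + 1))
        - B * \<beta> * (catalan (2 * n + 1) * (\<beta> / 8) ^ (2 * n + 1))) / (2 * v))
      sums ((A * \<alpha> * (- 4 * \<beta> - u * (R + \<beta> ^ 2)) - B * \<beta> * (- 4 * \<alpha> + u * (\<alpha> ^ 2 + \<alpha> * R))) / (2 * v))"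
    by (intro sums_divide sums_diff sums_mult O)
  have sum4: "(\<lambda>n. (A * \<alpha> * (catalan (2 * n + 1) * (\<alpha> / 8) ^ (2 * n + 1))
        + B * \<beta> * (catalan (2 * n + 1) * (\<beta> / 8) ^ (2 * n + 1))) / 2)
      sums ((A * \<alpha> * (- 4 * \<beta> - u * (R + \<beta> ^ 2)) + B * \<beta> * (- 4 * \<alpha> + u * (\<alpha> ^ 2 + \<alpha> * R))) / 2)"
    by (intro sums_divide sums_add sums_mult O)
  show ?thesis
    using sum1 sum2 sum3 sum4
    unfolding even_term odd_term val1 val2 val3 val4
    unfolding u_def v_def R_def by blast
qed

end
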